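(* Let $d\ge 2$, $D=\{1,\dots,d\}$, and let $\lambda=\lambda_1\otimes\cdots\otimes\lambda_d$ be a product of finite, positive, nonzero measures on $\Omega=\Omega_1\times\cdots\times\Omega_d$. Any $f_\mu\in\mathcal{B}^2(\lambda)$ can be decomposed in the form \[ f_\mu=\bigoplus_{I\subseteq D} g_{\mu,I}, \] where each $g_{\mu,I}$ depends only on the variables with indices in $I$ and, for any $I\subseteq D$, $g_{\mu,I}$ is given by \[ g_{\mu,I}=\Bigl(\prod_{i\in I}(\mathrm{id}-P_i)\Bigr)P_{D\setminus I}(f_\mu). \]
   Context: Bayes space. For a finite, positive, nonzero measure $\lambda$ on a measurable space $(\Omega,\mathcal{A})$, $\mathcal{M}(\lambda)$ is the set of $\sigma$-finite positive measures $\mu$ on $(\Omega,\mathcal A)$ with the same null sets as $\lambda$; $\mu$ is identified with its $\lambda$-density $f_\mu=d\mu/d\lambda$. Write $f_\mu\propto f_\nu$ if $f_\mu=c f_\nu$ ($\lambda$-a.e.) for some $c\in(0,\infty)$. The Bayes space is $\mathcal{B}(\lambda)=\mathcal{M}(\lambda)/\!\propto$; equality of elements means $\propto$. Vector space operations: $f\oplus g\propto fg$, $\alpha\odot f\propto f^{\alpha}$, $f\ominus g=f\oplus((-1)\odot g)$; the neutral element is the constant density $1$. $\mathcal{B}^2(\lambda)=\{f\in\mathcal{B}(\lambda):\int_\Omega|\ln f|^2d\lambda<\infty\}$. Product setting. For $i\in D$, $(\Omega_i,\mathcal{A}_i,\lambda_i)$ is a measurable space with a finite, positive, nonzero measure;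 $\Omega=\prod_{i\in D}\Omega_i$, $\mathcal A=\bigotimes_{i\in D}\mathcal A_i$, $\lambda=\bigotimes_{i\in D}\lambda_i$; $\Omega_I,\lambda_I$ are the corresponding products over $i\in I$. Geometric margins. For non-empty $I\subsetneq D$, $f_{\mu,I}\propto\exp\{\frac{1}{\lambda_{D\setminus I}(\Omega_{D\setminus I})}\int_{\Omega_{D\setminus I}}\ln(f_\mu)\,d\lambda_{D\setminus I}\}$; $f_{\mu,D}=f_\mu$; $f_{\mu,\varnothing}=\exp\{\frac1{\lambda(\Omega)}\int_\Omega\ln(f_\mu)\,d\lambda\}\propto1$. Operators. For $I\subseteq D$, $P_{D\setminus I}(f_\mu)=f_{\mu,I}$; so $P_\varnothing=\mathrm{id}$, and $P_i=P_{\{i\}}$ maps $f_\mu$ to $f_{\mu,D\setminus\{i\}}$. Products of operators denote composition (an empty product is $\mathrm{id}$), and differences are taken in the vector space $(\mathcal{B}^2(\lambda),\oplus,\odot)$: $(\mathrm{id}-P_i)(f)=f\ominus P_i(f)$. *)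

theory Defs
  imports "HOL-Probability.Probability" "HOL-Algebra.FiniteProduct"
begin

definition bayes_measures :: "'a measure \<Rightarrow> 'a measure set" where
  "bayes_measures lam =
    {\<mu>. sigma_finite_measure \<mu> \<and> sets \<mu> = sets lam \<and> null_sets \<mu> = null_sets lam}"

text \<open>Measures are identified with their (real-valued) densities. Equality of the null sets forces
  a density \<open>f\<close> in this set to be strictly positive almost everywhere, so the truncation of
  negative values by \<open>ennreal\<close> is harmless; lemma \<open>bayes_measures_density\<close> below shows that
  every measure in \<open>bayes_measures lam\<close> arises in this way.\<close>

definition bayes_densities :: "'a measure \<Rightarrow> ('a \<Rightarrow> real) set" where
  "bayes_densities lam =
    {f \<in> borel_measurable lam. density lam (\<lambda>x. ennreal (f x)) \<in> bayes_measures lam}"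

lemma bayes_measures_density:
  assumes "finite_measure lam" and "\<mu> \<in> bayes_measures lam"
  shows "\<exists>f\<in>bayes_densities lam. \<mu> = density lam (\<lambda>x. ennreal (f x))"
proof -
  interpret L: finite_measure lam by fact
  have s: "sigma_finite_measure \<mu>" "sets \<mu> = sets lam" "null_sets \<mu> = null_sets lam"
    using assms(2) by (auto simp: bayes_measures_def)
  have ac: "absolutely_continuous lam \<mu>"
    using s by (simp add: absolutely_continuous_def)
  have fin: "AE x in lam. RN_deriv lam \<mu> x \<noteq> \<infinity>"
    by (rule L.RN_deriv_finite[OF s(1) ac s(2)])
  have "\<mu> = density lam (RN_deriv lam \<mu>)"
    using L.density_RN_deriv[OF ac s(2)] by simp
  also have "\<dots> = density lam (\<lambda>x. ennreal (enn2real (RN_deriv lam \<mu> x)))"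
    using fin by (intro density_cong) (auto simp: less_top)
  finally have eq: "\<mu> = density lam (\<lambda>x. ennreal (enn2real (RN_deriv lam \<mu> x)))" .
  then have "(\<lambda>x. enn2real (RN_deriv lam \<mu> x)) \<in> bayes_densities lam"
    using assms(2) by (auto simp: bayes_densities_def)
  then show ?thesis
    by (rule bexI[rotated]) (rule eq)
qed

definition bayes_prop :: "'a measure \<Rightarrow> (('a \<Rightarrow> real) \<times> ('a \<Rightarrow> real)) set" where
  "bayes_prop lam =
    {(f, g). f \<in> bayes_densities lam \<and> g \<in> bayes_densities lam \<and>
             (\<exists>c>0. AE x in lam. f x = c * g x)}"

definition bayes_space :: "'a measure \<Rightarrow> ('a \<Rightarrow> real) set set" where
  "bayes_space lam = bayes_densities lam // bayes_prop lam"

definition bayes_class :: "'a measure \<Rightarrow> ('a \<Rightarrow> real) \<Rightarrow> ('a \<Rightarrow> real) set" where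
  "bayes_class lam f = bayes_prop lam `` {f}"

definition bayes_L2 :: "'a measure \<Rightarrow> ('a \<Rightarrow> real) set set" where
  "bayes_L2 lam =
    {F \<in> bayes_space lam. \<forall>f\<in>F. integrable lam (\<lambda>x. \<bar>ln (f x)\<bar>\<^sup>2)}"

text \<open>Operations on equivalence classes are the unions of the classes obtained from all
  representatives; when the operation respects proportionality, this is a single class.\<close>

definition bayes_add ::
  "'a measure \<Rightarrow> ('a \<Rightarrow> real) set \<Rightarrow> ('a \<Rightarrow> real) set \<Rightarrow> ('a \<Rightarrow> real) set" where
  "bayes_add lam F G = (\<Union>f\<in>F. \<Union>g\<in>G. bayes_class lam (\<lambda>x. f x * g x))"

definition bayes_scale ::
  "'a measure \<Rightarrow> real \<Rightarrow> ('a \<Rightarrow> real) set \<Rightarrow> ('a \<Rightarrow> real) set" where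
  "bayes_scale lam \<alpha> F = (\<Union>f\<in>F. bayes_class lam (\<lambda>x. f x powr \<alpha>))"

definition bayes_diff ::
  "'a measure \<Rightarrow> ('a \<Rightarrow> real) set \<Rightarrow> ('a \<Rightarrow> real) set \<Rightarrow> ('a \<Rightarrow> real) set" where
  "bayes_diff lam F G = bayes_add lam F (bayes_scale lam (-1) G)"

text \<open>The additive group of the vector space, written as a (multiplicative) monoid record so
  that finite sums of classes are given by \<open>finprod\<close>.\<close>

definition bayes_L2_group :: "'a measure \<Rightarrow> ('a \<Rightarrow> real) set monoid" where
  "bayes_L2_group lam =
    \<lparr>carrier = bayes_L2 lam, monoid.mult = bayes_add lam, one = bayes_class lam (\<lambda>_. 1)\<rparr>"

text \<open>Margins are viewed as functions on the full product space that use only the coordinates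
  in \<open>I\<close>. For \<open>I = {}\<close> the integral runs over the full space.\<close>

definition geo_margin ::
  "'i set \<Rightarrow> ('i \<Rightarrow> 'a measure) \<Rightarrow> 'i set \<Rightarrow> (('i \<Rightarrow> 'a) \<Rightarrow> real) \<Rightarrow> ('i \<Rightarrow> 'a) \<Rightarrow> real" where
  "geo_margin D M I f =
    (if I = D then f
     else (\<lambda>x. exp (1 / measure (PiM (D - I) M) (space (PiM (D - I) M)) *
                 (\<integral>y. ln (f (merge I (D - I) (x, y))) \<partial>PiM (D - I) M))))"

definition bayes_P ::
  "'i set \<Rightarrow> ('i \<Rightarrow> 'a measure) \<Rightarrow> 'i set \<Rightarrow> (('i \<Rightarrow> 'a) \<Rightarrow> real) set \<Rightarrow> (('i \<Rightarrow> 'a) \<Rightarrow> real) set" where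
  "bayes_P D M J F = (\<Union>f\<in>F. bayes_class (PiM D M) (geo_margin D M (D - J) f))"

definition id_minus_P ::
  "'i set \<Rightarrow> ('i \<Rightarrow> 'a measure) \<Rightarrow> 'i \<Rightarrow> (('i \<Rightarrow> 'a) \<Rightarrow> real) set \<Rightarrow> (('i \<Rightarrow> 'a) \<Rightarrow> real) set" where
  "id_minus_P D M i F = bayes_diff (PiM D M) F (bayes_P D M {i} F)"

text \<open>The composition is taken in increasing order of the indices; for the commuting operators
  \<open>id_minus_P D M i\<close> on \<open>bayes_L2\<close> the order is immaterial.\<close>

definition op_prod :: "('i::linorder \<Rightarrow> 'b \<Rightarrow> 'b) \<Rightarrow> 'i set \<Rightarrow> 'b \<Rightarrow> 'b" where
  "op_prod T I = foldr (\<circ>) (map T (sorted_list_of_set I)) id"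

text \<open>A class depends only on the variables in \<open>I\<close> if some density representing it factors
  through the projection onto the coordinates in \<open>I\<close>.\<close>

definition depends_only_on ::
  "'i set \<Rightarrow> ('i \<Rightarrow> 'a measure) \<Rightarrow> 'i set \<Rightarrow> (('i \<Rightarrow> 'a) \<Rightarrow> real) set \<Rightarrow> bool" where
  "depends_only_on D M I F \<longleftrightarrow>
    (\<exists>f\<in>F. \<exists>h\<in>borel_measurable (PiM I M). \<forall>x\<in>space (PiM D M). f x = h (restrict x I))"

end

theory Submission
  imports Defs
begin

text \<open>
  Taking logarithms turns the Bayes space into a space of functions modulo constants: products of
  densities become sums, powers become scalar multiples, and the geometric margin on the
  coordinates \<open>A\<close> becomes the arithmetic mean \<open>m\<^sub>A u\<close> of \<open>u = ln f\<close> over the coordinates outside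
  \<open>A\<close> (\<open>log_margin\<close>). The statement is then the Hoeffding, or functional ANOVA, decomposition of a
  square integrable function, and it rests on two facts.

  The first is Fubini: \<open>m\<^sub>A (m\<^sub>B u) = m\<^bsub>A \<inter> B\<^esub> u\<close> almost everywhere whenever \<open>A \<union> B = D\<close>
  (\<open>log_margin_log_margin\<close>). Applying \<open>id - P\<^sub>i\<close> for all \<open>i \<in> I\<close>, one after the other, to
  \<open>m\<^sub>I u\<close> therefore produces the alternating sum
  \<open>\<Sum>J\<subseteq>I. (-1) ^ card J * m\<^bsub>I - J\<^esub> u\<close> (\<open>foldr_id_minus_P\<close>). It involves only coordinates in
  \<open>I\<close>, and it does not remember the order in which the operators were applied.

  The second is Moebius inversion on the lattice of subsets of \<open>D\<close>: the sum of these alternating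
  sums over all \<open>I \<subseteq> D\<close> is \<open>m\<^sub>D u = u\<close> (\<open>sum_log_interaction\<close>), and this identity holds at every
  point of the product space.

  The remaining work is the passage between classes of densities and functions. The elements of
  \<open>bayes_L2\<close> are exactly the classes of \<open>exp u\<close> with \<open>u\<close> square integrable, and the
  operations on classes act on \<open>u\<close> as described. Averaging preserves square integrability
  because the square of a mean is at most the mean of the square
  (\<open>square_integrable_log_margin\<close>).
\<close>

section \<open>The Bayes space in logarithmic coordinates\<close>

definition square_integrable :: "'a measure \<Rightarrow> ('a \<Rightarrow> real) set" where
  "square_integrable lam = {u \<in> borel_measurable lam. integrable lam (\<lambda>x. (u x)\<^sup>2)}"

definition exp_class :: "'a measure \<Rightarrow> ('a \<Rightarrow> real) \<Rightarrow> ('a \<Rightarrow> real) set" where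
  "exp_class lam u = bayes_class lam (\<lambda>x. exp (u x))"

lemma square_integrable_measurable: "u \<in> square_integrable lam \<Longrightarrow> u \<in> borel_measurable lam"
  by (simp add: square_integrable_def)

lemma square_integrable_cmult:
  assumes "u \<in> square_integrable lam"
  shows "(\<lambda>x. c * u x) \<in> square_integrable lam"
  using assms by (auto simp: square_integrable_def power_mult_distrib)

lemma square_integrable_add:
  assumes "u \<in> square_integrable lam" "v \<in> square_integrable lam"
  shows "(\<lambda>x. u x + v x) \<in> square_integrable lam"
proof -
  have [measurable]: "u \<in> borel_measurable lam" "v \<in> borel_measurable lam"
    using assms by (auto simp: square_integrable_def)
  have "integrable lam (\<lambda>x. 2 * (u x)\<^sup>2 + 2 * (v x)\<^sup>2)"
    using assms by (auto simp: square_integrable_def)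
  then have "integrable lam (\<lambda>x. (u x + v x)\<^sup>2)"
  proof (rule Bochner_Integration.integrable_bound)
    have "(a + b)\<^sup>2 \<le> 2 * a\<^sup>2 + 2 * b\<^sup>2" for a b :: real
      using sum_squares_bound[of a b] by (simp add: power2_sum)
    then show "AE x in lam. norm ((u x + v x)\<^sup>2) \<le> norm (2 * (u x)\<^sup>2 + 2 * (v x)\<^sup>2)"
      by auto
  qed simp
  then show ?thesis
    by (simp add: square_integrable_def)
qed

lemma square_integrable_diff:
  assumes "u \<in> square_integrable lam" "v \<in> square_integrable lam"
  shows "(\<lambda>x. u x - v x) \<in> square_integrable lam"
  using square_integrable_add[OF assms(1) square_integrable_cmult[OF assms(2), of "-1"]] by simp

lemma square_integrable_sum:
  assumes "finite A" "\<And>i. i \<in> A \<Longrightarrow> u i \<in> square_integrable lam"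
  shows "(\<lambda>x. \<Sum>i\<in>A. u i x) \<in> square_integrable lam"
  using assms
proof (induction A rule: finite_induct)
  case empty
  show ?case by (simp add: square_integrable_def)
next
  case (insert i A)
  then show ?case by (simp add: square_integrable_add)
qed

context finite_measure
begin

lemma square_integrable_const: "(\<lambda>_. c) \<in> square_integrable M"
  by (simp add: square_integrable_def)

lemma square_integrable_integrable: "u \<in> square_integrable M \<Longrightarrow> integrable M u"
  by (auto simp: square_integrable_def intro: square_integrable_imp_integrable)

lemma square_integrable_AE_shift:
  assumes "u \<in> square_integrable M" "v \<in> borel_measurable M" "AE x in M. v x = u x + c"
  shows "v \<in> square_integrable M"
proof -
  have "(\<lambda>x. u x + c) \<in> square_integrable M"
    by (intro square_integrable_add square_integrable_const assms)
  moreover from this have "integrable M (\<lambda>x. (v x)\<^sup>2) \<longleftrightarrow> integrable M (\<lambda>x. (u x + c)\<^sup>2)"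
    using assms by (intro integrable_cong_AE) (auto simp: square_integrable_def)
  ultimately show ?thesis
    using assms(2) by (simp add: square_integrable_def)
qed

text \<open>A finite real density with respect to a finite measure always gives a sigma-finite measure, so
  only the null sets matter. The set where \<open>f\<close> is not positive is null for the measure with
  density \<open>f\<close>, hence has to be null for \<open>M\<close>.\<close>

lemma bayes_densities_iff:
  "f \<in> bayes_densities M \<longleftrightarrow> f \<in> borel_measurable M \<and> (AE x in M. f x > 0)"
proof (cases "f \<in> borel_measurable M")
  case [measurable]: True
  have sf: "sigma_finite_measure (density M (\<lambda>x. ennreal (f x)))"
    by (subst sigma_finite_iff_density_finite) auto
  have "(null_sets (density M (\<lambda>x. ennreal (f x))) = null_sets M) \<longleftrightarrow> (AE x in M. f x > 0)"
  proof
    assume eq: "null_sets (density M (\<lambda>x. ennreal (f x))) = null_sets M"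
    have "{x \<in> space M. \<not> f x > 0} \<in> null_sets (density M (\<lambda>x. ennreal (f x)))"
      by (subst null_sets_density_iff) (auto simp: ennreal_eq_0_iff not_less)
    then show "AE x in M. f x > 0"
      unfolding eq by (auto simp: AE_iff_null)
  next
    assume pos: "AE x in M. f x > 0"
    show "null_sets (density M (\<lambda>x. ennreal (f x))) = null_sets M"
    proof (rule Set.set_eqI)
      fix N
      have "(AE x in M. x \<in> N \<longrightarrow> ennreal (f x) = 0) \<longleftrightarrow> (AE x in M. x \<notin> N)"
      proof
        assume "AE x in M. x \<in> N \<longrightarrow> ennreal (f x) = 0"
        with pos show "AE x in M. x \<notin> N"
          by eventually_elim (auto simp: ennreal_eq_0_iff)
      qed auto
      then show "N \<in> null_sets (density M (\<lambda>x. ennreal (f x))) \<longleftrightarrow> N \<in> null_sets M"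
        using AE_iff_null_sets[of N M]
        by (subst null_sets_density_iff) (auto dest: null_setsD2)
    qed
  qed
  with sf show ?thesis
    by (simp add: bayes_densities_def bayes_measures_def)
qed (simp add: bayes_densities_def)

text \<open>The proportionality factor is written as \<open>exp c\<close>: proportionality of densities is equality
  of logarithms up to an additive constant.\<close>

lemma exp_class_iff:
  assumes u: "u \<in> borel_measurable M"
  shows "f \<in> exp_class M u \<longleftrightarrow>
    f \<in> borel_measurable M \<and> (\<exists>c. AE x in M. f x = exp (u x + c))"
proof
  assume "f \<in> exp_class M u"
  then obtain c where f: "f \<in> bayes_densities M" and c: "c > 0" "AE x in M. exp (u x) = c * f x"
    by (auto simp: exp_class_def bayes_class_def bayes_prop_def)
  have "AE x in M. f x = exp (u x + (- ln c))"
    using c(2) by eventually_elim (use c(1) in \<open>simp add: exp_diff\<close>)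
  then have "\<exists>c. AE x in M. f x = exp (u x + c)"
    by (rule exI)
  with f show "f \<in> borel_measurable M \<and> (\<exists>c. AE x in M. f x = exp (u x + c))"
    by (simp add: bayes_densities_iff)
next
  assume "f \<in> borel_measurable M \<and> (\<exists>c. AE x in M. f x = exp (u x + c))"
  then obtain c where f: "f \<in> borel_measurable M" and c: "AE x in M. f x = exp (u x + c)"
    by auto
  have "AE x in M. f x > 0"
    using c by eventually_elim simp
  moreover have "AE x in M. exp (u x) = exp (- c) * f x"
    using c by eventually_elim (simp flip: exp_add)
  ultimately show "f \<in> exp_class M u"
    using f u by (auto simp: exp_class_def bayes_class_def bayes_prop_def bayes_densities_iff
      intro!: exI[of _ "exp (- c)"])
qed

lemma exp_class_self: "u \<in> borel_measurable M \<Longrightarrow> (\<lambda>x. exp (u x)) \<in> exp_class M u"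
  by (auto simp: exp_class_iff intro!: exI[of _ 0])

lemma exp_class_memE:
  assumes "u \<in> borel_measurable M" "f \<in> exp_class M u"
  obtains c where "f \<in> borel_measurable M" "AE x in M. f x = exp (u x + c)"
  using assms by (auto simp: exp_class_iff)

lemma bayes_class_eq_exp_class:
  assumes u: "u \<in> borel_measurable M" and f: "f \<in> borel_measurable M"
    and fu: "AE x in M. f x = exp (u x + c)"
  shows "bayes_class M f = exp_class M u"
proof -
  have pos: "AE x in M. f x > 0"
    using fu by eventually_elim simp
  have "(\<exists>a>0. AE x in M. f x = a * g x) \<longleftrightarrow> (\<exists>a>0. AE x in M. exp (u x) = a * g x)" for g
  proof safe
    fix a :: real assume "a > 0" and *: "AE x in M. f x = a * g x"
    have "AE x in M. exp (u x) = exp (- c) * a * g x"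
      using * fu by eventually_elim (simp add: exp_add exp_minus field_simps)
    with \<open>a > 0\<close> show "\<exists>a>0. AE x in M. exp (u x) = a * g x"
      by (intro exI[of _ "exp (- c) * a"]) simp
  next
    fix a :: real assume "a > 0" and *: "AE x in M. exp (u x) = a * g x"
    have "AE x in M. f x = exp c * a * g x"
      using * fu by eventually_elim (simp add: exp_add)
    with \<open>a > 0\<close> show "\<exists>a>0. AE x in M. f x = a * g x"
      by (intro exI[of _ "exp c * a"]) simp
  qed
  with pos f u show ?thesis
    by (auto simp: exp_class_def bayes_class_def bayes_prop_def bayes_densities_iff)
qed

lemma exp_class_cong:
  assumes "u \<in> borel_measurable M" "v \<in> borel_measurable M" "AE x in M. v x = u x"
  shows "exp_class M v = exp_class M u"
  unfolding exp_class_def[of M v]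
  by (rule bayes_class_eq_exp_class[where c = 0]) (use assms in auto)

lemma bayes_one_eq: "bayes_class M (\<lambda>_. 1) = exp_class M (\<lambda>_. 0)"
  by (simp add: exp_class_def)

lemma exp_class_in_bayes_L2:
  assumes u: "u \<in> square_integrable M"
  shows "exp_class M u \<in> bayes_L2 M"
proof -
  note um [measurable] = square_integrable_measurable[OF u]
  have "(\<lambda>x. exp (u x)) \<in> bayes_densities M"
    by (auto simp: bayes_densities_iff)
  then have "exp_class M u \<in> bayes_space M"
    by (auto simp: exp_class_def bayes_space_def bayes_class_def quotient_def)
  moreover have "integrable M (\<lambda>x. \<bar>ln (f x)\<bar>\<^sup>2)" if f: "f \<in> exp_class M u" for f
  proof -
    obtain c where [measurable]: "f \<in> borel_measurable M" and c: "AE x in M. f x = exp (u x + c)"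
      using exp_class_memE[OF um f] .
    have "(\<lambda>x. ln (f x)) \<in> square_integrable M"
      by (rule square_integrable_AE_shift[OF u, of _ c]) (use c in auto)
    then show ?thesis
      by (simp add: square_integrable_def)
  qed
  ultimately show ?thesis
    by (auto simp: bayes_L2_def)
qed

lemma bayes_L2_obtain_log:
  assumes "F \<in> bayes_L2 M"
  obtains u where "u \<in> square_integrable M" "F = exp_class M u"
proof -
  from assms obtain f where f: "f \<in> bayes_densities M" and F: "F = bayes_class M f"
    and int: "\<And>g. g \<in> F \<Longrightarrow> integrable M (\<lambda>x. \<bar>ln (g x)\<bar>\<^sup>2)"
    by (auto simp: bayes_L2_def bayes_space_def bayes_class_def quotient_def)
  from f have [measurable]: "f \<in> borel_measurable M" and pos: "AE x in M. f x > 0"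
    by (auto simp: bayes_densities_iff)
  have "f \<in> F"
    using f by (auto simp: F bayes_class_def bayes_prop_def intro!: exI[of _ 1])
  then have "(\<lambda>x. ln (f x)) \<in> square_integrable M"
    using int[of f] by (simp add: square_integrable_def)
  moreover have "F = exp_class M (\<lambda>x. ln (f x))"
    unfolding F by (rule bayes_class_eq_exp_class[where c = 0]) (use pos in auto)
  ultimately show ?thesis
    using that by blast
qed

text \<open>All operations on classes are unions over representatives. If an operation sends every
  representative of one class into a single other class, the union collapses to that class. This
  settles well-definedness for addition, scaling and margins alike.\<close>

lemma exp_class_UN_eq:
  assumes u: "u \<in> borel_measurable M"
    and v: "v \<in> borel_measurable M"
    and op: "\<And>f c. f \<in> borel_measurable M \<Longrightarrow> AE x in M. f x = exp (u x + c) \<Longrightarrow>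
      h f \<in> borel_measurable M \<and> (\<exists>c'. AE x in M. h f x = exp (v x + c'))"
  shows "(\<Union>f\<in>exp_class M u. bayes_class M (h f)) = exp_class M v"
proof -
  have "bayes_class M (h f) = exp_class M v" if "f \<in> exp_class M u" for f
    using exp_class_memE[OF u that] op bayes_class_eq_exp_class[OF v] by metis
  then show ?thesis
    using exp_class_self[OF u] by blast
qed

lemma bayes_add_exp_class:
  assumes [measurable]: "u \<in> borel_measurable M" "v \<in> borel_measurable M"
  shows "bayes_add M (exp_class M u) (exp_class M v) = exp_class M (\<lambda>x. u x + v x)"
proof -
  have "(\<Union>g\<in>exp_class M v. bayes_class M (\<lambda>x. f x * g x)) = exp_class M (\<lambda>x. u x + v x)"
    if f: "f \<in> exp_class M u" for f
  proof (rule exp_class_UN_eq)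
    obtain c where [measurable]: "f \<in> borel_measurable M" and c: "AE x in M. f x = exp (u x + c)"
      using exp_class_memE[OF _ f] by auto
    fix g c' assume [measurable]: "g \<in> borel_measurable M" and c': "AE x in M. g x = exp (v x + c')"
    have "AE x in M. f x * g x = exp (u x + v x + (c + c'))"
      using c c' by eventually_elim (simp add: exp_add)
    then show "(\<lambda>x. f x * g x) \<in> borel_measurable M \<and>
      (\<exists>c'. AE x in M. f x * g x = exp (u x + v x + c'))"
      by auto
  qed auto
  then show ?thesis
    using exp_class_self[of u] unfolding bayes_add_def by auto
qed

lemma bayes_scale_exp_class:
  assumes [measurable]: "u \<in> borel_measurable M"
  shows "bayes_scale M a (exp_class M u) = exp_class M (\<lambda>x. a * u x)"
  unfolding bayes_scale_def
proof (rule exp_class_UN_eq)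
  fix f c assume [measurable]: "f \<in> borel_measurable M" and c: "AE x in M. f x = exp (u x + c)"
  have "AE x in M. f x powr a = exp (a * u x + a * c)"
    using c by eventually_elim (simp add: powr_def distrib_left)
  then show "(\<lambda>x. f x powr a) \<in> borel_measurable M \<and>
      (\<exists>c'. AE x in M. f x powr a = exp (a * u x + c'))"
    by auto
qed auto

lemma bayes_diff_exp_class:
  assumes [measurable]: "u \<in> borel_measurable M" "v \<in> borel_measurable M"
  shows "bayes_diff M (exp_class M u) (exp_class M v) = exp_class M (\<lambda>x. u x - v x)"
  by (simp add: bayes_diff_def bayes_scale_exp_class bayes_add_exp_class)

text \<open>The laws are those of pointwise addition of logarithms; they make \<open>finprod\<close> a genuine
  finite sum of classes.\<close>

lemma comm_monoid_bayes_L2_group: "comm_monoid (bayes_L2_group M)"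
proof (rule comm_monoidI; simp add: bayes_L2_group_def bayes_one_eq)
  note logs = bayes_L2_obtain_log
  note simps = square_integrable_measurable bayes_add_exp_class
  note in_L2 = exp_class_in_bayes_L2
  show "exp_class M (\<lambda>_. 0) \<in> bayes_L2 M"
    by (intro in_L2 square_integrable_const)
  fix F assume F: "F \<in> bayes_L2 M"
  show "bayes_add M (exp_class M (\<lambda>_. 0)) F = F"
    by (rule logs[OF F]) (simp add: simps)
  fix G assume G: "G \<in> bayes_L2 M"
  show "bayes_add M F G \<in> bayes_L2 M"
    by (rule logs[OF F], rule logs[OF G]) (simp add: simps in_L2 square_integrable_add)
  show "bayes_add M F G = bayes_add M G F"
    by (rule logs[OF F], rule logs[OF G]) (simp add: simps add.commute)
  fix H assume H: "H \<in> bayes_L2 M"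
  show "bayes_add M (bayes_add M F G) H = bayes_add M F (bayes_add M G H)"
    by (rule logs[OF F], rule logs[OF G], rule logs[OF H]) (simp add: simps square_integrable_add add.assoc)
qed

lemma finprod_exp_class:
  assumes "finite A" "\<And>i. i \<in> A \<Longrightarrow> u i \<in> square_integrable M"
  shows "finprod (bayes_L2_group M) (\<lambda>i. exp_class M (u i)) A = exp_class M (\<lambda>x. \<Sum>i\<in>A. u i x)"
proof -
  interpret G: comm_monoid "bayes_L2_group M"
    by (rule comm_monoid_bayes_L2_group)
  show ?thesis
    using assms
  proof (induction A rule: finite_induct)
    case empty
    show ?case
      by (simp add: bayes_one_eq) (simp add: bayes_L2_group_def bayes_one_eq)
  next
    case (insert i A)
    have "(\<lambda>i. exp_class M (u i)) \<in> insert i A \<rightarrow> carrier (bayes_L2_group M)"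
      using insert.prems by (auto simp: bayes_L2_group_def intro!: exp_class_in_bayes_L2)
    then have "finprod (bayes_L2_group M) (\<lambda>i. exp_class M (u i)) (insert i A) =
        bayes_add M (exp_class M (u i)) (exp_class M (\<lambda>x. \<Sum>i\<in>A. u i x))"
      using insert by (subst G.finprod_insert) (auto simp: bayes_L2_group_def)
    also have "\<dots> = exp_class M (\<lambda>x. \<Sum>i\<in>insert i A. u i x)"
      using insert square_integrable_sum[of A u M]
      by (subst bayes_add_exp_class) (auto intro!: square_integrable_measurable)
    finally show ?case .
  qed
qed

end


section \<open>Margins in logarithmic coordinates\<close>

text \<open>Finiteness and non-triviality are demanded of every factor, also outside \<open>D\<close>, because
  the locale \<open>product_sigma_finite\<close> ranges over the whole index type.\<close>

locale finite_measure_family =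
  fixes M :: "'i \<Rightarrow> 'a measure" and D :: "'i set"
  assumes finite_D: "finite D"
    and finite_factor: "\<And>i. finite_measure (M i)"
    and nonzero_factor: "\<And>i. emeasure (M i) (space (M i)) \<noteq> 0"

sublocale finite_measure_family \<subseteq> product_sigma_finite M
  by (intro product_sigma_finite.intro finite_measure.axioms(1) finite_factor)

context finite_measure_family
begin

lemma
  assumes "finite I"
  shows finite_measure_PiM: "finite_measure (PiM I M)"
    and measure_PiM_space:
      "measure (PiM I M) (space (PiM I M)) = (\<Prod>i\<in>I. measure (M i) (space (M i)))"
proof -
  have "emeasure (PiM I M) (space (PiM I M)) = (\<Prod>i\<in>I. emeasure (M i) (space (M i)))"
    unfolding space_PiM using assms by (intro emeasure_PiM) auto
  also have "\<dots> = (\<Prod>i\<in>I. ennreal (measure (M i) (space (M i))))"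
    by (intro prod.cong refl finite_measure.emeasure_eq_measure finite_factor)
  also have "\<dots> = ennreal (\<Prod>i\<in>I. measure (M i) (space (M i)))"
    by (simp add: prod_ennreal)
  finally have eq: "emeasure (PiM I M) (space (PiM I M)) = \<dots>" .
  then show "finite_measure (PiM I M)"
    by (intro finite_measureI) simp
  show "measure (PiM I M) (space (PiM I M)) = (\<Prod>i\<in>I. measure (M i) (space (M i)))"
    using eq by (simp add: measure_def prod_nonneg)
qed

lemma measure_PiM_space_pos: "finite I \<Longrightarrow> measure (PiM I M) (space (PiM I M)) > 0"
  unfolding measure_PiM_space
  using finite_measure.emeasure_eq_measure[OF finite_factor] nonzero_factor
  by (intro prod_pos) (metis ennreal_0 zero_less_measure_iff)

sublocale PD: finite_measure "PiM D M"
  by (rule finite_measure_PiM[OF finite_D])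

text \<open>The mean over the coordinates outside \<open>A\<close>. The case \<open>A = D\<close> is the mean over the one-point
  space \<open>PiM {} M\<close> and gives back \<open>u\<close> (\<open>log_margin_full\<close>), so in contrast to \<open>geo_margin\<close> no
  case distinction is made.\<close>

definition log_margin :: "'i set \<Rightarrow> (('i \<Rightarrow> 'a) \<Rightarrow> real) \<Rightarrow> ('i \<Rightarrow> 'a) \<Rightarrow> real" where
  "log_margin A u x = 1 / measure (PiM (D - A) M) (space (PiM (D - A) M)) *
     (\<integral>y. u (merge A (D - A) (x, y)) \<partial>PiM (D - A) M)"

lemma merge_restrict_left:
  assumes "A \<subseteq> A'"
  shows "merge A B (restrict x A', y) = merge A B (x, y)"
  using assms by (auto simp: merge_def fun_eq_iff)

lemma log_margin_restrict: "A \<subseteq> A' \<Longrightarrow> log_margin A u (restrict x A') = log_margin A u x"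
  by (simp add: log_margin_def merge_restrict_left)

lemma log_margin_full:
  assumes "x \<in> space (PiM D M)"
  shows "log_margin D u x = u x"
proof -
  have "merge D {} (x, y) = x" for y
    using assms by (auto simp: merge_def fun_eq_iff space_PiM PiE_def extensional_def)
  moreover have "measure (PiM {} M) (space (PiM {} M)) = 1"
    by (subst measure_PiM_space) auto
  ultimately show ?thesis
    by (simp add: log_margin_def)
qed

lemma measurable_merge_sub:
  assumes "A \<subseteq> I" "A \<subseteq> D"
  shows "merge A (D - A) \<in> measurable (PiM I M \<Otimes>\<^sub>M PiM (D - A) M) (PiM D M)"
proof -
  have "A \<union> (D - A) = D"
    using assms by auto
  moreover have "(\<lambda>p. merge A (D - A) (restrict (fst p) A, snd p))
      \<in> measurable (PiM I M \<Otimes>\<^sub>M PiM (D - A) M) (PiM (A \<union> (D - A)) M)"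
    using measurable_compose[OF measurable_fst measurable_restrict_subset[OF assms(1), of M]]
    by (intro measurable_compose[OF measurable_Pair measurable_merge] measurable_snd)
  ultimately show ?thesis
    by (simp add: merge_restrict_left)
qed

lemma log_margin_measurable:
  assumes "A \<subseteq> I" "A \<subseteq> D" and [measurable]: "u \<in> borel_measurable (PiM D M)"
  shows "log_margin A u \<in> borel_measurable (PiM I M)"
proof -
  interpret B: finite_measure "PiM (D - A) M"
    by (rule finite_measure_PiM) (simp add: finite_D)
  note [measurable] = measurable_merge_sub[OF assms(1,2)]
  show ?thesis
    unfolding log_margin_def[abs_def] by measurable
qed

lemma PiM_split:
  assumes "A \<subseteq> D"
  shows "PiM D M = distr (PiM A M \<Otimes>\<^sub>M PiM (D - A) M) (PiM D M) (merge A (D - A))"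
proof -
  have "A \<union> (D - A) = D"
    using assms by auto
  then show ?thesis
    using distr_merge[of A "D - A"] finite_subset[OF assms finite_D] finite_D by simp
qed

lemma pair_sigma_finite_split:
  assumes "A \<subseteq> D"
  shows "pair_sigma_finite (PiM A M) (PiM (D - A) M)"
  using finite_measure_PiM[of A] finite_measure_PiM[of "D - A"] finite_subset[OF assms finite_D] finite_D
  by (simp add: pair_sigma_finite_def finite_measure_def)

lemma restrict_merge_left:
  assumes "x \<in> space (PiM A M)"
  shows "restrict (merge A B (x, y)) A = x"
  using assms by (auto simp: merge_def fun_eq_iff space_PiM PiE_def extensional_def restrict_def)

text \<open>The Fubini theorems speak about almost all points of \<open>PiM A M\<close>, whereas margins live on the
  full space. This lemma and the next transport such statements: the cylinder over a null set is a
  null set, and the cylindrical extension of an integrable function is integrable because the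
  complementary factor has finite mass.\<close>

lemma AE_lift_coordinates:
  assumes A: "A \<subseteq> D" and P: "AE z in PiM A M. P z"
  shows "AE x in PiM D M. P (restrict x A)"
proof -
  interpret pair_sigma_finite "PiM A M" "PiM (D - A) M"
    by (rule pair_sigma_finite_split[OF A])
  from P obtain N where N: "N \<in> null_sets (PiM A M)" "{z \<in> space (PiM A M). \<not> P z} \<subseteq> N"
    by (auto simp: eventually_ae_filter)
  note [measurable] = measurable_merge_sub[OF subset_refl A] null_setsD2[OF N(1)]
    measurable_restrict_subset[OF A, of M]
  have "AE p in PiM A M \<Otimes>\<^sub>M PiM (D - A) M. fst p \<notin> N"
  proof (rule AE_pair_measure)
    show "AE x in PiM A M. AE y in PiM (D - A) M. fst (x, y) \<notin> N"
      using AE_not_in[OF N(1)] by eventually_elim simp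
  qed measurable
  then have "AE p in PiM A M \<Otimes>\<^sub>M PiM (D - A) M. restrict (merge A (D - A) p) A \<notin> N"
    using AE_space
    by eventually_elim (auto simp: space_pair_measure space_PiM)
  then have "AE x in PiM D M. restrict x A \<notin> N"
    by (subst PiM_split[OF A], subst AE_distr_iff) measurable
  then show ?thesis
    using AE_space
  proof eventually_elim
    case (elim x)
    have "restrict x A \<in> space (PiM A M)"
      using elim(2) A by (auto simp: space_PiM)
    with elim N(2) show ?case
      by auto
  qed
qed

lemma integrable_lift_coordinates:
  fixes h :: "('i \<Rightarrow> 'a) \<Rightarrow> real"
  assumes A: "A \<subseteq> D" and h: "integrable (PiM A M) h"
  shows "integrable (PiM D M) (\<lambda>x. h (restrict x A))"
proof -
  interpret pair_sigma_finite "PiM A M" "PiM (D - A) M"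
    by (rule pair_sigma_finite_split[OF A])
  interpret B: finite_measure "PiM (D - A) M"
    by (rule finite_measure_PiM) (simp add: finite_D)
  note [measurable] = measurable_merge_sub[OF subset_refl A] borel_measurable_integrable[OF h]
    measurable_restrict_subset[OF A, of M]
  have "integrable (PiM A M \<Otimes>\<^sub>M PiM (D - A) M) (\<lambda>p. h (fst p))"
    by (rule Fubini_integrable) (use h in auto)
  moreover have "h (fst p) = h (restrict (merge A (D - A) p) A)"
    if "p \<in> space (PiM A M \<Otimes>\<^sub>M PiM (D - A) M)" for p
    using that by (auto simp: space_pair_measure space_PiM)
  ultimately have "integrable (PiM A M \<Otimes>\<^sub>M PiM (D - A) M) (\<lambda>p. h (restrict (merge A (D - A) p) A))"
    by (subst (asm) Bochner_Integration.integrable_cong[OF refl])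
  then show ?thesis
    by (subst PiM_split[OF A], subst integrable_distr_eq) measurable
qed

lemma AE_sections:
  assumes A: "A \<subseteq> D" and P: "AE x in PiM D M. P x"
  shows "AE x in PiM D M. AE y in PiM (D - A) M. P (merge A (D - A) (x, y))"
proof -
  interpret pair_sigma_finite "PiM A M" "PiM (D - A) M"
    by (rule pair_sigma_finite_split[OF A])
  have "AE p in PiM A M \<Otimes>\<^sub>M PiM (D - A) M. P (merge A (D - A) p)"
    using P by (subst (asm) PiM_split[OF A])
      (rule AE_distrD[OF measurable_merge_sub[OF subset_refl A], where P = P])
  then have "AE z in PiM A M. AE y in PiM (D - A) M. P (merge A (D - A) (z, y))"
    by (rule AE_pair)
  from AE_lift_coordinates[OF A this] show ?thesis
    by (simp add: merge_restrict_left)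
qed

lemma
  fixes u :: "('i \<Rightarrow> 'a) \<Rightarrow> real"
  assumes A: "A \<subseteq> D" and u: "integrable (PiM D M) u"
  shows AE_integrable_sections:
      "AE x in PiM D M. integrable (PiM (D - A) M) (\<lambda>y. u (merge A (D - A) (x, y)))"
    and integrable_log_margin: "integrable (PiM D M) (log_margin A u)"
proof -
  interpret pair_sigma_finite "PiM A M" "PiM (D - A) M"
    by (rule pair_sigma_finite_split[OF A])
  have int: "integrable (PiM A M \<Otimes>\<^sub>M PiM (D - A) M) (\<lambda>p. u (merge A (D - A) p))"
    using u by (subst (asm) PiM_split[OF A]) (rule integrable_distr[OF measurable_merge_sub[OF subset_refl A]])
  show "AE x in PiM D M. integrable (PiM (D - A) M) (\<lambda>y. u (merge A (D - A) (x, y)))"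
    using AE_lift_coordinates[OF A AE_integrable_fst'[OF int]] by (simp add: merge_restrict_left)
  have "integrable (PiM A M) (log_margin A u)"
    unfolding log_margin_def[abs_def] using integrable_fst'[OF int] by simp
  from integrable_lift_coordinates[OF A this] show "integrable (PiM D M) (log_margin A u)"
    by (simp add: log_margin_restrict)
qed

text \<open>Margins respect the identifications made in the Bayes space: a change on a null set does not
  affect almost all sections, and averaging keeps an additive constant because the mean is
  normalized by the total mass.\<close>

lemma log_margin_AE_shift:
  assumes A: "A \<subseteq> D" and u: "integrable (PiM D M) u" and [measurable]: "v \<in> borel_measurable (PiM D M)"
    and uv: "AE x in PiM D M. v x = u x + c"
  shows "AE x in PiM D M. log_margin A v x = log_margin A u x + c"
  using AE_integrable_sections[OF A u] AE_sections[OF A uv] AE_space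
proof eventually_elim
  case (elim x)
  interpret B: finite_measure "PiM (D - A) M"
    by (rule finite_measure_PiM) (simp add: finite_D)
  let ?m = "measure (PiM (D - A) M) (space (PiM (D - A) M))"
  have pos: "?m > 0"
    by (rule measure_PiM_space_pos) (simp add: finite_D)
  have [measurable]: "(\<lambda>y. merge A (D - A) (x, y)) \<in> measurable (PiM (D - A) M) (PiM D M)"
    by (rule measurable_compose[OF measurable_Pair1' measurable_merge_sub]) (use elim A in auto)
  have "(\<integral>y. v (merge A (D - A) (x, y)) \<partial>PiM (D - A) M)
      = (\<integral>y. u (merge A (D - A) (x, y)) + c \<partial>PiM (D - A) M)"
    using elim by (intro integral_cong_AE) (auto dest: borel_measurable_integrable)
  also have "\<dots> = (\<integral>y. u (merge A (D - A) (x, y)) \<partial>PiM (D - A) M) + ?m * c"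
    using elim by simp
  finally show ?case
    using pos by (simp add: log_margin_def field_simps)
qed

lemma log_margin_linear:
  assumes A: "A \<subseteq> D" and S: "finite S" and u: "\<And>s. s \<in> S \<Longrightarrow> integrable (PiM D M) (u s)"
  shows "AE x in PiM D M. log_margin A (\<lambda>x. \<Sum>s\<in>S. c s * u s x) x = (\<Sum>s\<in>S. c s * log_margin A (u s) x)"
proof -
  have "AE x in PiM D M. \<forall>s\<in>S. integrable (PiM (D - A) M) (\<lambda>y. u s (merge A (D - A) (x, y)))"
    using S u by (intro AE_finite_allI AE_integrable_sections A) auto
  then show ?thesis
    by eventually_elim
      (simp add: log_margin_def Bochner_Integration.integral_sum sum_divide_distrib)
qed

text \<open>If \<open>A \<union> B = D\<close>, then the coordinates averaged out by the two margins are disjoint, and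
  Fubini merges the two averages into one over \<open>(D - A) \<union> (D - B) = D - A \<inter> B\<close>, whose total mass is
  the product of the two masses. Fubini applies at those points whose section over \<open>D - A \<inter> B\<close> is
  integrable, hence almost everywhere.\<close>

lemma log_margin_log_margin:
  assumes A: "A \<subseteq> D" and B: "B \<subseteq> D" and AB: "A \<union> B = D" and u: "integrable (PiM D M) u"
  shows "AE x in PiM D M. log_margin A (log_margin B u) x = log_margin (A \<inter> B) u x"
proof -
  have split: "D - A \<inter> B = (D - A) \<union> (D - B)" and disj: "(D - A) \<inter> (D - B) = {}"
    using A B AB by auto
  have fin: "finite (D - A)" "finite (D - B)"
    using finite_D by auto
  have meas: "measure (PiM (D - A \<inter> B) M) (space (PiM (D - A \<inter> B) M)) =
      measure (PiM (D - A) M) (space (PiM (D - A) M)) * measure (PiM (D - B) M) (space (PiM (D - B) M))"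
    unfolding split using fin disj by (simp add: measure_PiM_space prod.union_disjoint)
  have merge: "merge B (D - B) (merge A (D - A) (x, z), y) =
      merge (A \<inter> B) (D - A \<inter> B) (x, merge (D - A) (D - B) (z, y))" for x y z :: "'i \<Rightarrow> 'a"
    using A B AB by (auto simp: merge_def fun_eq_iff)
  have "A \<inter> B \<subseteq> D"
    using A by auto
  from AE_integrable_sections[OF this u] show ?thesis
  proof eventually_elim
    case (elim x)
    have "(\<integral>w. u (merge (A \<inter> B) (D - A \<inter> B) (x, w)) \<partial>PiM (D - A \<inter> B) M) =
        (\<integral>z. (\<integral>y. u (merge B (D - B) (merge A (D - A) (x, z), y)) \<partial>PiM (D - B) M) \<partial>PiM (D - A) M)"
      unfolding merge using product_integral_fold[OF disj fin, of "\<lambda>w. u (merge (A \<inter> B) (D - A \<inter> B) (x, w))"]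
        elim by (simp add: split)
    then show ?case
      by (simp add: log_margin_def meas mult.commute)
  qed
qed

text \<open>The square of a mean is at most the mean of the square, and the latter is
  integrable by Fubini.\<close>

lemma square_integrable_log_margin:
  assumes A: "A \<subseteq> D" and u: "u \<in> square_integrable (PiM D M)"
  shows "log_margin A u \<in> square_integrable (PiM D M)"
proof -
  have [measurable]: "u \<in> borel_measurable (PiM D M)" and sq: "integrable (PiM D M) (\<lambda>x. (u x)\<^sup>2)"
    using u by (auto simp: square_integrable_def)
  note u_int = PD.square_integrable_integrable[OF u]
  have meas: "log_margin A u \<in> borel_measurable (PiM D M)"
    by (rule log_margin_measurable) (use A in auto)
  have "integrable (PiM D M) (\<lambda>x. (log_margin A u x)\<^sup>2)"
  proof (rule Bochner_Integration.integrable_bound[OF integrable_log_margin[OF A sq]])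
    show "AE x in PiM D M. norm ((log_margin A u x)\<^sup>2) \<le> norm (log_margin A (\<lambda>x. (u x)\<^sup>2) x)"
      using AE_integrable_sections[OF A u_int] AE_integrable_sections[OF A sq]
    proof eventually_elim
      case (elim x)
      interpret B: finite_measure "PiM (D - A) M"
        by (rule finite_measure_PiM) (simp add: finite_D)
      let ?m = "measure (PiM (D - A) M) (space (PiM (D - A) M))"
      let ?c = "log_margin A u x"
      let ?s = "\<integral>y. (u (merge A (D - A) (x, y)))\<^sup>2 \<partial>PiM (D - A) M"
      have pos: "?m > 0"
        by (rule measure_PiM_space_pos) (simp add: finite_D)
      have c: "(\<integral>y. u (merge A (D - A) (x, y)) \<partial>PiM (D - A) M) = ?m * ?c"
        using pos by (simp add: log_margin_def)
      \<comment> \<open>\<open>?c\<close> is the mean of the section, and its variance is nonnegative\<close>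
      have "0 \<le> (\<integral>y. (u (merge A (D - A) (x, y)) - ?c)\<^sup>2 \<partial>PiM (D - A) M)"
        by simp
      also have "\<dots> = (\<integral>y. (u (merge A (D - A) (x, y)))\<^sup>2 - 2 * ?c * u (merge A (D - A) (x, y)) + ?c\<^sup>2 \<partial>PiM (D - A) M)"
        by (simp add: power2_diff algebra_simps)
      also have "\<dots> = ?s - 2 * ?c * (?m * ?c) + ?m * ?c\<^sup>2"
        using elim by (simp add: c)
      finally have "?m * ?c\<^sup>2 \<le> ?s"
        by (simp add: power2_eq_square algebra_simps)
      then have "?c\<^sup>2 \<le> log_margin A (\<lambda>x. (u x)\<^sup>2) x"
        using pos by (simp add: log_margin_def[of A "\<lambda>x. (u x)\<^sup>2"] field_simps)
      then show ?case
        by simp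
    qed
  qed (use meas in simp)
  with meas show ?thesis
    by (simp add: square_integrable_def)
qed

lemma bayes_P_exp_class:
  assumes u: "u \<in> square_integrable (PiM D M)"
  shows "bayes_P D M J (exp_class (PiM D M) u) = exp_class (PiM D M) (log_margin (D - J) u)"
  unfolding bayes_P_def
proof (rule PD.exp_class_UN_eq)
  show "u \<in> borel_measurable (PiM D M)"
    using u by (rule square_integrable_measurable)
  then show meas: "log_margin (D - J) u \<in> borel_measurable (PiM D M)"
    by (intro log_margin_measurable) auto
  fix f c assume f [measurable]: "f \<in> borel_measurable (PiM D M)"
    and c: "AE x in PiM D M. f x = exp (u x + c)"
  have ln: "AE x in PiM D M. ln (f x) = u x + c"
    using c by eventually_elim simp
  show "geo_margin D M (D - J) f \<in> borel_measurable (PiM D M) \<and>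
      (\<exists>c'. AE x in PiM D M. geo_margin D M (D - J) f x = exp (log_margin (D - J) u x + c'))"
  proof (cases "D - J = D")
    case True
    have "AE x in PiM D M. f x = exp (log_margin D u x + c)"
      using c AE_space by eventually_elim (simp add: log_margin_full)
    then show ?thesis
      unfolding True by (auto simp: geo_margin_def)
  next
    case False
    then have eq: "geo_margin D M (D - J) f = (\<lambda>x. exp (log_margin (D - J) (\<lambda>x. ln (f x)) x))"
      by (simp add: geo_margin_def log_margin_def)
    have "AE x in PiM D M. log_margin (D - J) (\<lambda>x. ln (f x)) x = log_margin (D - J) u x + c"
      by (rule log_margin_AE_shift) (use ln PD.square_integrable_integrable[OF u] in auto)
    then have "AE x in PiM D M. geo_margin D M (D - J) f x = exp (log_margin (D - J) u x + c)"
      unfolding eq by eventually_elim simp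
    moreover have "geo_margin D M (D - J) f \<in> borel_measurable (PiM D M)"
      unfolding eq using log_margin_measurable[of "D - J" D "\<lambda>x. ln (f x)"] by auto
    ultimately show ?thesis
      by blast
  qed
qed

lemma id_minus_P_exp_class:
  assumes u: "u \<in> square_integrable (PiM D M)"
  shows "id_minus_P D M i (exp_class (PiM D M) u) =
    exp_class (PiM D M) (\<lambda>x. u x - log_margin (D - {i}) u x)"
  unfolding id_minus_P_def bayes_P_exp_class[OF u]
  by (rule PD.bayes_diff_exp_class)
    (use square_integrable_log_margin[OF _ u, of "D - {i}"] u in \<open>auto dest: square_integrable_measurable\<close>)

section \<open>The decomposition\<close>

text \<open>The effect of \<open>id - P\<^sub>i\<close> for all \<open>i \<in> K\<close> on the margin on \<open>I\<close>, in closed form. The set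
  \<open>K\<close> is kept separate from \<open>I\<close> so that the operators can be applied one at a time; the case
  \<open>K = I\<close> is the interaction term of the decomposition.\<close>

definition log_interaction ::
  "'i set \<Rightarrow> 'i set \<Rightarrow> (('i \<Rightarrow> 'a) \<Rightarrow> real) \<Rightarrow> ('i \<Rightarrow> 'a) \<Rightarrow> real" where
  "log_interaction I K u x = (\<Sum>J\<in>Pow K. (-1) ^ card J * log_margin (I - J) u x)"

lemma square_integrable_log_interaction:
  assumes "K \<subseteq> I" "I \<subseteq> D" "u \<in> square_integrable (PiM D M)"
  shows "log_interaction I K u \<in> square_integrable (PiM D M)"
  unfolding log_interaction_def[abs_def]
  using finite_subset[OF _ finite_D, of K] assms
  by (intro square_integrable_sum square_integrable_cmult square_integrable_log_margin) auto

text \<open>The subsets of \<open>insert i K\<close> are the sets \<open>J\<close> and \<open>insert i J\<close> with \<open>J \<subseteq> K\<close>. Averaging over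
  coordinate \<open>i\<close> turns the margin on \<open>I - J\<close> into the margin on \<open>I - insert i J\<close>, so the subtracted
  terms are those of the second kind, with the sign that the larger cardinality requires.\<close>

lemma log_interaction_insert:
  assumes u: "u \<in> square_integrable (PiM D M)" and "insert i K \<subseteq> I" "I \<subseteq> D" "i \<notin> K"
  shows "AE x in PiM D M. log_interaction I K u x - log_margin (D - {i}) (log_interaction I K u) x =
    log_interaction I (insert i K) u x"
proof -
  have finK: "finite K"
    using assms finite_subset[OF _ finite_D] by auto
  have int: "integrable (PiM D M) (log_margin (I - J) u)" for J
    by (rule integrable_log_margin) (use assms PD.square_integrable_integrable in auto)
  have compose: "AE x in PiM D M. \<forall>J\<in>Pow K.
      log_margin (D - {i}) (log_margin (I - J) u) x = log_margin ((D - {i}) \<inter> (I - J)) u x"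
  proof (intro AE_finite_allI log_margin_log_margin)
    fix J assume "J \<in> Pow K"
    then show "D - {i} \<union> (I - J) = D"
      using assms by auto
  qed (use assms finK PD.square_integrable_integrable in auto)
  have index: "(D - {i}) \<inter> (I - J) = I - insert i J" for J
    using assms by auto
  have linear: "AE x in PiM D M. log_margin (D - {i}) (log_interaction I K u) x =
      (\<Sum>J\<in>Pow K. (-1) ^ card J * log_margin (D - {i}) (log_margin (I - J) u) x)"
    unfolding log_interaction_def[abs_def]
    by (rule log_margin_linear) (use finK int in auto)
  have "AE x in PiM D M. log_margin (D - {i}) (log_interaction I K u) x =
      (\<Sum>J\<in>Pow K. (-1) ^ card J * log_margin (I - insert i J) u x)"
    using compose linear by eventually_elim (auto simp: index intro!: sum.cong)
  moreover have "log_interaction I (insert i K) u x = log_interaction I K u x -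
      (\<Sum>J\<in>Pow K. (-1) ^ card J * log_margin (I - insert i J) u x)" for x
  proof -
    have "(\<Sum>J\<in>insert i ` Pow K. (-1) ^ card J * log_margin (I - J) u x) =
        (\<Sum>J\<in>Pow K. (-1) ^ card (insert i J) * log_margin (I - insert i J) u x)"
      using \<open>i \<notin> K\<close> by (intro sum.reindex_cong[of "insert i"]) (auto simp: inj_on_def)
    also have "\<dots> = (\<Sum>J\<in>Pow K. - ((-1) ^ card J * log_margin (I - insert i J) u x))"
    proof (rule sum.cong[OF refl])
      fix J assume "J \<in> Pow K"
      then have "finite J" "i \<notin> J"
        using finK \<open>i \<notin> K\<close> finite_subset by auto
      then show "(-1) ^ card (insert i J) * log_margin (I - insert i J) u x =
          - ((-1) ^ card J * log_margin (I - insert i J) u x)"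
        by simp
    qed
    finally show ?thesis
      unfolding log_interaction_def Pow_insert using finK \<open>i \<notin> K\<close>
      by (subst sum.union_disjoint) (auto simp: sum_negf)
  qed
  ultimately show ?thesis
    by simp
qed

lemma foldr_id_minus_P:
  assumes u: "u \<in> square_integrable (PiM D M)" and I: "I \<subseteq> D"
  shows "distinct l \<Longrightarrow> set l \<subseteq> I \<Longrightarrow>
    foldr (\<circ>) (map (id_minus_P D M) l) id (exp_class (PiM D M) (log_margin I u)) =
    exp_class (PiM D M) (log_interaction I (set l) u)"
proof (induction l)
  case Nil
  show ?case
    by (simp add: log_interaction_def[abs_def])
next
  case (Cons i l)
  let ?v = "log_interaction I (set l) u"
  have v: "?v \<in> square_integrable (PiM D M)"
    by (rule square_integrable_log_interaction) (use Cons.prems u I in auto)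
  have v': "log_margin (D - {i}) ?v \<in> square_integrable (PiM D M)"
    by (rule square_integrable_log_margin) (use v in auto)
  have w: "log_interaction I (set (i # l)) u \<in> square_integrable (PiM D M)"
    by (rule square_integrable_log_interaction) (use Cons.prems u I in auto)
  have IH: "foldr (\<circ>) (map (id_minus_P D M) l) id (exp_class (PiM D M) (log_margin I u)) =
      exp_class (PiM D M) ?v"
    using Cons.prems by (intro Cons.IH) auto
  have "foldr (\<circ>) (map (id_minus_P D M) (i # l)) id (exp_class (PiM D M) (log_margin I u)) =
      id_minus_P D M i (exp_class (PiM D M) ?v)"
    by (simp only: list.map foldr_Cons o_apply IH)
  also have "\<dots> = exp_class (PiM D M) (\<lambda>x. ?v x - log_margin (D - {i}) ?v x)"
    by (rule id_minus_P_exp_class[OF v])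
  also have "\<dots> = exp_class (PiM D M) (log_interaction I (set (i # l)) u)"
    by (rule PD.exp_class_cong)
      (use log_interaction_insert[OF u, of i "set l" I] Cons.prems I v v' w
        in \<open>auto dest: square_integrable_measurable intro: borel_measurable_diff\<close>)
  finally show ?case .
qed

text \<open>Replacing \<open>J\<close> by \<open>T = I - J\<close> shows that \<open>(-1) ^ card I * log_interaction I I u x\<close> is
  the alternating sum of \<open>log_margin T u x\<close> over \<open>T \<subseteq> I\<close>. This is the form in which
  the symmetric version of inclusion-exclusion inverts it.\<close>

lemma sum_log_interaction:
  assumes "x \<in> space (PiM D M)"
  shows "(\<Sum>I\<in>Pow D. log_interaction I I u x) = u x"
proof -
  have "(-1) ^ card S * log_interaction S S u x = (\<Sum>T\<in>Pow S. (-1) ^ card T * log_margin T u x)"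
    if S: "finite S" for S
  proof -
    have "(-1) ^ card S * log_interaction S S u x =
        (\<Sum>J\<in>Pow S. (-1) ^ (card S + card J) * log_margin (S - J) u x)"
      by (simp add: log_interaction_def sum_distrib_left power_add mult.assoc)
    also have "\<dots> = (\<Sum>T\<in>Pow S. (-1) ^ card T * log_margin T u x)"
    proof (rule sum.reindex_bij_witness[of _ "\<lambda>T. S - T" "\<lambda>J. S - J"])
      fix J assume "J \<in> Pow S"
      then have "card S + card J = card (S - J) + 2 * card J"
        using S by (auto simp: card_Diff_subset finite_subset card_mono)
      then show "(-1) ^ card (S - J) * log_margin (S - J) u x =
          (-1) ^ (card S + card J) * log_margin (S - J) u x"
        by (simp add: power_add)
    qed auto
    finally show ?thesis .
  qed
  then have "log_margin D u x = (\<Sum>T\<in>Pow D. (-1) ^ card T * ((-1) ^ card T * log_interaction T T u x))"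
    by (rule inclusion_exclusion_symmetric[OF _ finite_D])
  also have "\<dots> = (\<Sum>I\<in>Pow D. log_interaction I I u x)"
    by (simp flip: mult.assoc power_add)
  finally show ?thesis
    using assms by (simp add: log_margin_full)
qed

lemma depends_only_on_log_interaction:
  assumes u: "u \<in> square_integrable (PiM D M)" and I: "I \<subseteq> D"
  shows "depends_only_on D M I (exp_class (PiM D M) (log_interaction I I u))"
  unfolding depends_only_on_def
proof (intro bexI ballI)
  have [measurable]: "log_margin (I - J) u \<in> borel_measurable (PiM I M)" for J
    using square_integrable_measurable[OF u] I by (intro log_margin_measurable) auto
  show "(\<lambda>x. exp (log_interaction I I u x)) \<in> borel_measurable (PiM I M)"
    unfolding log_interaction_def by measurable
  show "exp (log_interaction I I u x) = exp (log_interaction I I u (restrict x I))" for x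
    by (simp add: log_interaction_def log_margin_restrict)
  show "(\<lambda>x. exp (log_interaction I I u x)) \<in> exp_class (PiM D M) (log_interaction I I u)"
    by (intro PD.exp_class_self square_integrable_measurable square_integrable_log_interaction)
      (use u I in auto)
qed

end

text \<open>The decomposition over an arbitrary finite, linearly ordered index set; the order only
  fixes the sequence in which \<open>op_prod\<close> composes its factors.\<close>

theorem anova_decomposition:
  fixes F :: "(('i::linorder \<Rightarrow> 'a) \<Rightarrow> real) set"
  assumes family: "finite_measure_family M D" and F: "F \<in> bayes_L2 (PiM D M)"
  shows "F = finprod (bayes_L2_group (PiM D M))
        (\<lambda>I. op_prod (id_minus_P D M) I (bayes_P D M (D - I) F)) (Pow D)" (is ?sum)
    and "I \<subseteq> D \<Longrightarrow> depends_only_on D M I (op_prod (id_minus_P D M) I (bayes_P D M (D - I) F))"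
proof -
  interpret finite_measure_family M D
    by (rule family)
  obtain u where u: "u \<in> square_integrable (PiM D M)" and Fu: "F = exp_class (PiM D M) u"
    using PD.bayes_L2_obtain_log[OF F] .
  have g: "op_prod (id_minus_P D M) I (bayes_P D M (D - I) F) = exp_class (PiM D M) (log_interaction I I u)"
    if I: "I \<subseteq> D" for I
  proof -
    have "finite I" "D - (D - I) = I"
      using I finite_subset[OF I finite_D] by auto
    then show ?thesis
      using foldr_id_minus_P[OF u I, of "sorted_list_of_set I"]
      by (simp add: op_prod_def Fu bayes_P_exp_class[OF u])
  qed
  then show "I \<subseteq> D \<Longrightarrow> depends_only_on D M I (op_prod (id_minus_P D M) I (bayes_P D M (D - I) F))"
    by (simp add: depends_only_on_log_interaction[OF u])
  have L2: "log_interaction I I u \<in> square_integrable (PiM D M)" if "I \<in> Pow D" for I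
    using that u by (intro square_integrable_log_interaction) auto
  interpret G: comm_monoid "bayes_L2_group (PiM D M)"
    by (rule PD.comm_monoid_bayes_L2_group)
  have "finprod (bayes_L2_group (PiM D M))
        (\<lambda>I. op_prod (id_minus_P D M) I (bayes_P D M (D - I) F)) (Pow D) =
      finprod (bayes_L2_group (PiM D M)) (\<lambda>I. exp_class (PiM D M) (log_interaction I I u)) (Pow D)"
    using L2 g by (intro G.finprod_cong')
      (auto simp: bayes_L2_group_def intro!: PD.exp_class_in_bayes_L2)
  also have "\<dots> = exp_class (PiM D M) (\<lambda>x. \<Sum>I\<in>Pow D. log_interaction I I u x)"
    using finite_D L2 by (intro PD.finprod_exp_class) auto
  also have "\<dots> = F"
    unfolding Fu
  proof (rule PD.exp_class_cong)
    show "AE x in PiM D M. (\<Sum>I\<in>Pow D. log_interaction I I u x) = u x"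
      by (rule AE_I2) (rule sum_log_interaction)
    show "(\<lambda>x. \<Sum>I\<in>Pow D. log_interaction I I u x) \<in> borel_measurable (PiM D M)"
      using finite_D L2 by (intro square_integrable_measurable square_integrable_sum) auto
  qed (rule square_integrable_measurable[OF u])
  finally show ?sum ..
qed

text \<open>The factors outside \<open>D\<close> may be exchanged at will, which allows them to be chosen finite and
  nonzero as \<open>finite_measure_family\<close> demands.\<close>

lemma
  assumes MN: "\<And>i. i \<in> D \<Longrightarrow> M i = N i"
  shows bayes_P_cong_factors: "bayes_P D M = bayes_P D N"
    and id_minus_P_cong_factors: "id_minus_P D M = id_minus_P D N"
    and depends_only_on_cong_factors: "I \<subseteq> D \<Longrightarrow> depends_only_on D M I = depends_only_on D N I"
proof -
  have PiM: "PiM I M = PiM I N" if "I \<subseteq> D" for I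
    using that MN by (intro PiM_cong) auto
  have geo: "geo_margin D M I = geo_margin D N I" for I
    by (intro ext) (simp add: geo_margin_def PiM)
  show P: "bayes_P D M = bayes_P D N"
    by (simp add: bayes_P_def[abs_def] geo PiM)
  show "id_minus_P D M = id_minus_P D N"
    by (simp add: id_minus_P_def[abs_def] P PiM)
  show "I \<subseteq> D \<Longrightarrow> depends_only_on D M I = depends_only_on D N I"
    by (simp add: depends_only_on_def[abs_def] PiM)
qed

theorem theorem4p1:
  fixes d :: nat and D :: "nat set" and M :: "nat \<Rightarrow> 'a measure"
    and F :: "((nat \<Rightarrow> 'a) \<Rightarrow> real) set"
  assumes "d \<ge> 2" and "D = {1..d}"
    and "\<And>i. i \<in> D \<Longrightarrow> finite_measure (M i)"
    and "\<And>i. i \<in> D \<Longrightarrow> emeasure (M i) (space (M i)) \<noteq> 0"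
    and "F \<in> bayes_L2 (PiM D M)"
  shows "\<exists>g. F = finprod (bayes_L2_group (PiM D M)) g (Pow D) \<and>
             (\<forall>I\<subseteq>D. depends_only_on D M I (g I) \<and>
                     g I = op_prod (id_minus_P D M) I (bayes_P D M (D - I) F))"
proof -
  \<comment> \<open>the factor with index 1 serves as a finite nonzero measure for the indices outside \<open>D\<close>\<close>
  define N where "N i = M (if i \<in> D then i else 1)" for i
  have "1 \<in> D"
    using assms(1,2) by simp
  then have family: "finite_measure_family N D"
    using assms(2-4) by (intro finite_measure_family.intro) (auto simp: N_def)
  have MN: "M i = N i" if "i \<in> D" for i
    using that by (simp add: N_def)
  have PiM: "PiM D M = PiM D N"
    using MN by (intro PiM_cong) auto
  have F: "F \<in> bayes_L2 (PiM D N)"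
    using assms(5) by (simp add: PiM)
  show ?thesis
    using anova_decomposition[OF family F]
    by (intro exI[of _ "\<lambda>I. op_prod (id_minus_P D M) I (bayes_P D M (D - I) F)"])
      (simp add: PiM bayes_P_cong_factors[OF MN] id_minus_P_cong_factors[OF MN]
        depends_only_on_cong_factors[OF MN])
qed

end
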